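(* For $0\le a\le a_2^*$ and $\#\in\{\mathrm{ET},\mathrm{ST}\}$, the performance-based Displaced-Gradient Algorithm, i.e. $p_{k+1}=p_k+\Delta_kX^a_{\mathrm{hb}}(p_k)$ with $\Delta_k=\mathrm{step}^{\mathrm p}_{\#}(p_k;a)$, has the following properties: (i) the stepsize $\Delta_k$ is uniformly lower bounded by the positive constant $\mathrm{MIET}(a)$; (ii) $V(p_k+tX^a_{\mathrm{hb}}(p_k))\le e^{-\frac{\sqrt\mu}{4}t}V(p_k)$ for all $t\in[0,\Delta_k]$ and all $k\in\{0\}\cup\mathbb{N}$. As a consequence, $f(x_{k+1})-f(x_* )=\mathcal O\big(e^{-\frac{\sqrt\mu}{4}\sum_{i=0}^k\Delta_i}\big)$.
   Context: Let $\mu,L,s>0$, and let $f:\mathbb{R}^n\to\mathbb{R}$ be continuously differentiable, $\mu$-strongly convex (i.e. $f(y)-f(x)\ge\langle\nabla f(x),y-x\rangle+\frac{\mu}{2}\|x-y\|^2$ for all $x,y$), with $L$-Lipschitz gradient; $x_*$ is its unique minimizer. Norms are Euclidean. Notation: $\sqrt{\mu_s}=1+\sqrt{\mu s}$, so $\mu_s=(1+\sqrt{\mu s})^2$. For $a\ge0$, $$X^a_{\mathrm{hb}}(x,v)=\begin{bmatrix} v\\ -2\sqrt{\mu}\,v-\sqrt{\mu_s}\,\nabla f(x+av)\end{bmatrix},$$ $$V(x,v)=\sqrt{\mu_s}\,(f(x)-f(x_* ))+\tfrac14\|v\|^2+\tfrac14\|v+2\sqrt{\mu}(x-x_* )\|^2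 .$$ For $\hat p=[\hat x,\hat v]^T$ write $\hat g=\nabla f(\hat x+a\hat v)$ and define $$b^{\mathrm d}_{\mathrm{ET}}(\hat p,t;a)=A_{\mathrm{ET}}(\hat p,t;a)+B_{\mathrm{ET}}(\hat p,t;a)+C_{\mathrm{ET}}(\hat p;a),$$ $$b^{\mathrm d}_{\mathrm{ST}}(\hat p,t;a)=B^q_{\mathrm{ST}}(\hat p;a)t^2+(A_{\mathrm{ST}}(\hat p;a)+B^l_{\mathrm{ST}}(\hat p;a))t+C_{\mathrm{ST}}(\hat p;a),$$ where $$A_{\mathrm{ET}}(\hat p,t;a)=2\mu t\|\hat v\|^2+\sqrt{\mu_s}\big(\langle\nabla f(\hat x+t\hat v)-\nabla f(\hat x),\hat v\rangle+2t\sqrt\mu\langle\hat g,\hat v\rangle+t\sqrt{\mu_s}\|\hat g\|^2\big),$$ $$B_{\mathrm{ET}}(\hat p,t;a)=\frac{\sqrt\mu t^2}{16}\|2\sqrt\mu\hat v+\sqrt{\mu_s}\hat g\|^2-\frac{t\mu}{4}\|\hat v\|^2+\frac{\sqrt\mu\sqrt{\mu_s}}{4}\Big(f(\hat x+t\hat v)-f(\hat x)-t\langle\hat v,\hat g\rangle+\frac{t^2\sqrt{\mu_s}}{4}\|\hat g\|^2-\frac{t\sqrt\mu}{L}\|\hat g\|^2+t\sqrt\mu\langle a\hat v,\hat g\rangle\Big),$$ $$C_{\mathrm{ET}}(\hat p;a)=-\frac{13\sqrt\mu}{16}\|\hat v\|^2-\frac{\mu^2\sqrt s}{2}\frac{\|\nabla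 f(\hat x)\|^2}{L^2}+\sqrt{\mu_s}\Big(-\frac{3\sqrt\mu}{8L}\|\nabla f(\hat x)\|^2+\sqrt\mu(f(\hat x)-f(\hat x+a\hat v))+\sqrt\mu\|\nabla f(\hat x)\|\|a\hat v\|-\frac{\mu^{3/2}}{2}\|a\hat v\|^2-\langle\hat g-\nabla f(\hat x),\hat v\rangle+\sqrt\mu\langle\hat g,a\hat v\rangle\Big),$$ $$A_{\mathrm{ST}}(\hat p;a)=2\mu\|\hat v\|^2+\sqrt{\mu_s}\big(L\|\hat v\|^2+2\sqrt\mu\langle\hat g,\hat v\rangle+\sqrt{\mu_s}\|\hat g\|^2\big),$$ $$B^l_{\mathrm{ST}}(\hat p;a)=\frac{\sqrt\mu}{4}\Big(-\sqrt\mu\|\hat v\|^2+\sqrt{\mu_s}\big(\langle\nabla f(\hat x)-\hat g,\hat v\rangle-\frac{\sqrt\mu}{L}\|\hat g\|^2+\sqrt\mu\langle a\hat v,\hat g\rangle\big)\Big),$$ $$B^q_{\mathrm{ST}}(\hat p;a)=\frac{\sqrt\mu}{16}\|2\sqrt\mu\hat v+\sqrt{\mu_s}\hat g\|^2+\frac{\sqrt\mu\sqrt{\mu_s}}{4}\Big(\frac L2\|\hat v\|^2+\frac{\sqrt{\mu_s}}{4}\|\hat g\|^2\Big),$$ $$C_{\mathrm{ST}}(\hat p;a)=C_{\mathrm{ET}}(\hat p;a).$$ Further, $b^{\mathrm p}_{\#}(\hat p,t;a)=\int_0^te^{\frac{\sqrt\mu}{4}\zeta}b^{\mathrm d}_{\#}(\hat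 p,\zeta;a)\,d\zeta$ for $\#\in\{\mathrm{ET},\mathrm{ST}\}$, and the stepsize is $\mathrm{step}^{\mathrm p}_{\#}(\hat p;a)=\min\{t>0: b^{\mathrm p}_{\#}(\hat p,t;a)=0\}$. Constants: let $$\hat\beta_1=\sqrt{\mu_s}\Big(\frac{3\sqrt\mu}{2}+L\Big),\quad \hat\beta_2=\frac32\sqrt\mu\sqrt{\mu_s},\quad \hat\beta_3=\frac{13\sqrt\mu}{16},\quad \hat\beta_4=\frac{4\mu^2\sqrt s+3L\sqrt\mu\sqrt{\mu_s}}{8L^2},\quad \hat\beta_5=\sqrt{\mu_s}\Big(\frac{5\sqrt\mu L}{2}-\frac{\mu^{3/2}}{2}\Big),$$ and, for a fixed $0<\alpha<1$, $$a_2^*=\alpha\min\Big\{\frac{-\hat\beta_1+\sqrt{\hat\beta_1^2+4\hat\beta_5\hat\beta_3}}{2\hat\beta_5},\ \frac{\hat\beta_4}{\hat\beta_2}\Big\}.$$ Also $\mathrm{MIET}(a)=-\nu+\sqrt{\nu^2+\eta}$, with $\eta=\min\{\eta_1,\eta_2\}$, $\nu=\max\{\nu_1,\nu_2\}$ and $$\eta_1=\frac{8a\sqrt{\mu_s}\big(a(\mu-5L)-\frac{2L}{\sqrt\mu}-3\big)+13}{2\sqrt{\mu_s}L(3a^2\sqrt{\mu_s}L+1)+8\mu},\qquad \eta_2=-\frac{3\sqrt{\mu_s}\sqrt\mu L(4aL-1)-4\mu^2\sqrt s}{3\mu_s\sqrt\mu L^2},$$ $$\nu_1=\frac{\mu(2a^3\sqrt{\mu_s}L^2+a\sqrt{\mu_s}+16)+8\sqrt{\mu_s}L(2a^2\sqrt{\mu_s}L+1)}{2\sqrt\mu\big(\sqrt{\mu_s}L(3a^2\sqrt{\mu_s}L+1)+4\mu\big)}+\frac{\sqrt{\mu_s}(aL(8aL+1)+4)}{\sqrt{\mu_s}L(3a^2\sqrt{\mu_s}L+1)+4\mu},$$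 $$\nu_2=\frac{a\mu+8\sqrt{\mu_s}+8\sqrt\mu}{3\sqrt{\mu_s}\sqrt\mu}.$$ Displaced-Gradient Algorithm (performance-based): given an initial point $p_0=[x_0,v_0]^T$, a tolerance $\epsilon>0$, and $a\ge0$, start with $k=0$; while $\|\nabla f(x_k)\|\ge\epsilon$, compute $\Delta_k=\mathrm{step}^{\mathrm p}_{\#}(p_k;a)$, set $p_{k+1}=[x_{k+1},v_{k+1}]^T=p_k+\Delta_kX^a_{\mathrm{hb}}(p_k)$, and increase $k$ by one. Assertions indexed by $k$ refer to the iterations actually performed. The $\mathcal O(\cdot)$ means an upper bound by a constant independent of $k$ times the given expression. *)

theory Defs
  imports "HOL-Analysis.Analysis"
begin

text \<open>Throughout, \<open>g\<close> stands for the gradient of \<open>f\<close>, and a state is a pair \<open>p = (x, v)\<close>.\<close>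

definition strongly_convex ::
    "real \<Rightarrow> ('a::real_inner \<Rightarrow> real) \<Rightarrow> ('a \<Rightarrow> 'a) \<Rightarrow> bool" where
  "strongly_convex mu f g \<longleftrightarrow>
     (\<forall>x y. f y - f x \<ge> g x \<bullet> (y - x) + mu / 2 * (norm (x - y))\<^sup>2)"

text \<open>\<open>sqmu mu s\<close> is the quantity written \<open>\<surd>\<mu>\<^sub>s\<close>, so that \<open>\<mu>\<^sub>s = (sqmu mu s)\<^sup>2\<close>.\<close>

definition sqmu :: "real \<Rightarrow> real \<Rightarrow> real" where
  "sqmu mu s = 1 + sqrt (mu * s)"

definition X_hb ::
    "('a::real_inner \<Rightarrow> 'a) \<Rightarrow> real \<Rightarrow> real \<Rightarrow> real \<Rightarrow> 'a \<times> 'a \<Rightarrow> 'a \<times> 'a" where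
  "X_hb g mu s a = (\<lambda>(x, v).
     (v, - (2 * sqrt mu) *\<^sub>R v - sqmu mu s *\<^sub>R g (x + a *\<^sub>R v)))"

definition V_lyap ::
    "('a::real_inner \<Rightarrow> real) \<Rightarrow> 'a \<Rightarrow> real \<Rightarrow> real \<Rightarrow> 'a \<times> 'a \<Rightarrow> real" where
  "V_lyap f xs mu s = (\<lambda>(x, v).
     sqmu mu s * (f x - f xs) + 1/4 * (norm v)\<^sup>2
       + 1/4 * (norm (v + (2 * sqrt mu) *\<^sub>R (x - xs)))\<^sup>2)"

definition A_ET ::
    "('a::real_inner \<Rightarrow> 'a) \<Rightarrow> real \<Rightarrow> real \<Rightarrow> real \<Rightarrow> 'a \<times> 'a \<Rightarrow> real \<Rightarrow> real" where
  "A_ET g mu s a = (\<lambda>(x, v) t. let gh = g (x + a *\<^sub>R v) in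
     2 * mu * t * (norm v)\<^sup>2
     + sqmu mu s *
         ((g (x + t *\<^sub>R v) - g x) \<bullet> v + 2 * t * sqrt mu * (gh \<bullet> v)
          + t * sqmu mu s * (norm gh)\<^sup>2))"

definition B_ET ::
    "('a::real_inner \<Rightarrow> real) \<Rightarrow> ('a \<Rightarrow> 'a) \<Rightarrow> real \<Rightarrow> real \<Rightarrow> real \<Rightarrow> real
      \<Rightarrow> 'a \<times> 'a \<Rightarrow> real \<Rightarrow> real" where
  "B_ET f g mu L s a = (\<lambda>(x, v) t. let gh = g (x + a *\<^sub>R v) in
     sqrt mu * t\<^sup>2 / 16 * (norm ((2 * sqrt mu) *\<^sub>R v + sqmu mu s *\<^sub>R gh))\<^sup>2
     - t * mu / 4 * (norm v)\<^sup>2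
     + sqrt mu * sqmu mu s / 4 *
         (f (x + t *\<^sub>R v) - f x - t * (v \<bullet> gh)
          + t\<^sup>2 * sqmu mu s / 4 * (norm gh)\<^sup>2
          - t * sqrt mu / L * (norm gh)\<^sup>2
          + t * sqrt mu * ((a *\<^sub>R v) \<bullet> gh)))"

definition C_ET ::
    "('a::real_inner \<Rightarrow> real) \<Rightarrow> ('a \<Rightarrow> 'a) \<Rightarrow> real \<Rightarrow> real \<Rightarrow> real \<Rightarrow> real
      \<Rightarrow> 'a \<times> 'a \<Rightarrow> real" where
  "C_ET f g mu L s a = (\<lambda>(x, v). let gh = g (x + a *\<^sub>R v) in
     - (13 * sqrt mu / 16) * (norm v)\<^sup>2
     - mu\<^sup>2 * sqrt s / 2 * ((norm (g x))\<^sup>2 / L\<^sup>2)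
     + sqmu mu s *
         (- (3 * sqrt mu / (8 * L)) * (norm (g x))\<^sup>2
          + sqrt mu * (f x - f (x + a *\<^sub>R v))
          + sqrt mu * norm (g x) * norm (a *\<^sub>R v)
          - mu powr (3/2) / 2 * (norm (a *\<^sub>R v))\<^sup>2
          - (gh - g x) \<bullet> v
          + sqrt mu * (gh \<bullet> (a *\<^sub>R v))))"

definition A_ST ::
    "('a::real_inner \<Rightarrow> 'a) \<Rightarrow> real \<Rightarrow> real \<Rightarrow> real \<Rightarrow> real \<Rightarrow> 'a \<times> 'a \<Rightarrow> real" where
  "A_ST g mu L s a = (\<lambda>(x, v). let gh = g (x + a *\<^sub>R v) in
     2 * mu * (norm v)\<^sup>2
     + sqmu mu s *
         (L * (norm v)\<^sup>2 + 2 * sqrt mu * (gh \<bullet> v) + sqmu mu s * (norm gh)\<^sup>2))"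

definition Bl_ST ::
    "('a::real_inner \<Rightarrow> 'a) \<Rightarrow> real \<Rightarrow> real \<Rightarrow> real \<Rightarrow> real \<Rightarrow> 'a \<times> 'a \<Rightarrow> real" where
  "Bl_ST g mu L s a = (\<lambda>(x, v). let gh = g (x + a *\<^sub>R v) in
     sqrt mu / 4 *
       (- sqrt mu * (norm v)\<^sup>2
        + sqmu mu s *
            ((g x - gh) \<bullet> v - sqrt mu / L * (norm gh)\<^sup>2
             + sqrt mu * ((a *\<^sub>R v) \<bullet> gh))))"

definition Bq_ST ::
    "('a::real_inner \<Rightarrow> 'a) \<Rightarrow> real \<Rightarrow> real \<Rightarrow> real \<Rightarrow> real \<Rightarrow> 'a \<times> 'a \<Rightarrow> real" where
  "Bq_ST g mu L s a = (\<lambda>(x, v). let gh = g (x + a *\<^sub>R v) in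
     sqrt mu / 16 * (norm ((2 * sqrt mu) *\<^sub>R v + sqmu mu s *\<^sub>R gh))\<^sup>2
     + sqrt mu * sqmu mu s / 4 *
         (L / 2 * (norm v)\<^sup>2 + sqmu mu s / 4 * (norm gh)\<^sup>2))"

abbreviation C_ST ::
    "('a::real_inner \<Rightarrow> real) \<Rightarrow> ('a \<Rightarrow> 'a) \<Rightarrow> real \<Rightarrow> real \<Rightarrow> real \<Rightarrow> real
      \<Rightarrow> 'a \<times> 'a \<Rightarrow> real" where
  "C_ST \<equiv> C_ET"

datatype trigger = ET | ST

definition b_d ::
    "trigger \<Rightarrow> ('a::real_inner \<Rightarrow> real) \<Rightarrow> ('a \<Rightarrow> 'a) \<Rightarrow> real \<Rightarrow> real \<Rightarrow> real \<Rightarrow> real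
      \<Rightarrow> 'a \<times> 'a \<Rightarrow> real \<Rightarrow> real" where
  "b_d tr f g mu L s a p t = (case tr of
     ET \<Rightarrow> A_ET g mu s a p t + B_ET f g mu L s a p t + C_ET f g mu L s a p
   | ST \<Rightarrow> Bq_ST g mu L s a p * t\<^sup>2 + (A_ST g mu L s a p + Bl_ST g mu L s a p) * t
           + C_ST f g mu L s a p)"

definition b_p ::
    "trigger \<Rightarrow> ('a::real_inner \<Rightarrow> real) \<Rightarrow> ('a \<Rightarrow> 'a) \<Rightarrow> real \<Rightarrow> real \<Rightarrow> real \<Rightarrow> real
      \<Rightarrow> 'a \<times> 'a \<Rightarrow> real \<Rightarrow> real" where
  "b_p tr f g mu L s a p t =
     integral {0..t} (\<lambda>z. exp (sqrt mu / 4 * z) * b_d tr f g mu L s a p z)"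

definition step_p ::
    "trigger \<Rightarrow> ('a::real_inner \<Rightarrow> real) \<Rightarrow> ('a \<Rightarrow> 'a) \<Rightarrow> real \<Rightarrow> real \<Rightarrow> real \<Rightarrow> real
      \<Rightarrow> 'a \<times> 'a \<Rightarrow> real" where
  "step_p tr f g mu L s a p = (LEAST t. t > 0 \<and> b_p tr f g mu L s a p t = 0)"

text \<open>The iteration without its stopping test; the test is \<open>performed\<close> below. The algorithm with
  tolerance \<open>eps\<close> executes exactly those iterations \<open>k\<close> for which \<open>performed\<close> holds.\<close>

primrec dg_iter ::
    "trigger \<Rightarrow> ('a::real_inner \<Rightarrow> real) \<Rightarrow> ('a \<Rightarrow> 'a) \<Rightarrow> real \<Rightarrow> real \<Rightarrow> real \<Rightarrow> real
      \<Rightarrow> 'a \<times> 'a \<Rightarrow> nat \<Rightarrow> 'a \<times> 'a" where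
  "dg_iter tr f g mu L s a p0 0 = p0"
| "dg_iter tr f g mu L s a p0 (Suc k) =
     (let p = dg_iter tr f g mu L s a p0 k
      in p + step_p tr f g mu L s a p *\<^sub>R X_hb g mu s a p)"

definition dg_step ::
    "trigger \<Rightarrow> ('a::real_inner \<Rightarrow> real) \<Rightarrow> ('a \<Rightarrow> 'a) \<Rightarrow> real \<Rightarrow> real \<Rightarrow> real \<Rightarrow> real
      \<Rightarrow> 'a \<times> 'a \<Rightarrow> nat \<Rightarrow> real" where
  "dg_step tr f g mu L s a p0 k = step_p tr f g mu L s a (dg_iter tr f g mu L s a p0 k)"

definition performed ::
    "trigger \<Rightarrow> ('a::real_inner \<Rightarrow> real) \<Rightarrow> ('a \<Rightarrow> 'a) \<Rightarrow> real \<Rightarrow> real \<Rightarrow> real \<Rightarrow> real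
      \<Rightarrow> 'a \<times> 'a \<Rightarrow> real \<Rightarrow> nat \<Rightarrow> bool" where
  "performed tr f g mu L s a p0 eps k \<longleftrightarrow>
     (\<forall>j\<le>k. norm (g (fst (dg_iter tr f g mu L s a p0 j))) \<ge> eps)"

definition beta1 :: "real \<Rightarrow> real \<Rightarrow> real \<Rightarrow> real" where
  "beta1 mu L s = sqmu mu s * (3 * sqrt mu / 2 + L)"

definition beta2 :: "real \<Rightarrow> real \<Rightarrow> real" where
  "beta2 mu s = 3/2 * sqrt mu * sqmu mu s"

definition beta3 :: "real \<Rightarrow> real" where
  "beta3 mu = 13 * sqrt mu / 16"

definition beta4 :: "real \<Rightarrow> real \<Rightarrow> real \<Rightarrow> real" where
  "beta4 mu L s = (4 * mu\<^sup>2 * sqrt s + 3 * L * sqrt mu * sqmu mu s) / (8 * L\<^sup>2)"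

definition beta5 :: "real \<Rightarrow> real \<Rightarrow> real \<Rightarrow> real" where
  "beta5 mu L s = sqmu mu s * (5 * sqrt mu * L / 2 - mu powr (3/2) / 2)"

definition a2_star :: "real \<Rightarrow> real \<Rightarrow> real \<Rightarrow> real \<Rightarrow> real" where
  "a2_star alpha mu L s = alpha * min
     ((- beta1 mu L s + sqrt ((beta1 mu L s)\<^sup>2 + 4 * beta5 mu L s * beta3 mu)) / (2 * beta5 mu L s))
     (beta4 mu L s / beta2 mu s)"

definition eta1 :: "real \<Rightarrow> real \<Rightarrow> real \<Rightarrow> real \<Rightarrow> real" where
  "eta1 mu L s a =
     (8 * a * sqmu mu s * (a * (mu - 5 * L) - 2 * L / sqrt mu - 3) + 13)
     / (2 * sqmu mu s * L * (3 * a\<^sup>2 * sqmu mu s * L + 1) + 8 * mu)"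

definition eta2 :: "real \<Rightarrow> real \<Rightarrow> real \<Rightarrow> real \<Rightarrow> real" where
  "eta2 mu L s a =
     - ((3 * sqmu mu s * sqrt mu * L * (4 * a * L - 1) - 4 * mu\<^sup>2 * sqrt s)
        / (3 * (sqmu mu s)\<^sup>2 * sqrt mu * L\<^sup>2))"

definition nu1 :: "real \<Rightarrow> real \<Rightarrow> real \<Rightarrow> real \<Rightarrow> real" where
  "nu1 mu L s a =
     (mu * (2 * a^3 * sqmu mu s * L\<^sup>2 + a * sqmu mu s + 16)
        + 8 * sqmu mu s * L * (2 * a\<^sup>2 * sqmu mu s * L + 1))
     / (2 * sqrt mu * (sqmu mu s * L * (3 * a\<^sup>2 * sqmu mu s * L + 1) + 4 * mu))
     + sqmu mu s * (a * L * (8 * a * L + 1) + 4)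
       / (sqmu mu s * L * (3 * a\<^sup>2 * sqmu mu s * L + 1) + 4 * mu)"

definition nu2 :: "real \<Rightarrow> real \<Rightarrow> real \<Rightarrow> real" where
  "nu2 mu s a = (a * mu + 8 * sqmu mu s + 8 * sqrt mu) / (3 * sqmu mu s * sqrt mu)"

definition MIET :: "real \<Rightarrow> real \<Rightarrow> real \<Rightarrow> real \<Rightarrow> real" where
  "MIET mu L s a =
     (let eta = min (eta1 mu L s a) (eta2 mu L s a); nu = max (nu1 mu L s a) (nu2 mu s a)
      in - nu + sqrt (nu\<^sup>2 + eta))"

end

(* Along the step p + t X(p), dV/dt + (sqrt mu / 4) V is bounded by b_d ET, by cocoercivity and
   strong convexity at the minimizer, and b_d ET is bounded by b_d ST, by the descent lemma.
   Integrating against exp (sqrt mu t / 4) shows that V decays at the rate sqrt mu / 4 as long as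
   b_p is nonpositive, that is, up to the first positive zero of b_p. This zero exists because b_d
   grows quadratically in t, and it is at least MIET because b_d ST is dominated by a nonnegative
   multiple of t^2 + 2 nu t - eta, which is negative on [0, MIET). *)

theory Submission
  imports Defs
begin

text \<open>A \<open>LEAST\<close> over the reals has meaning only when the minimum is attained, and
  the positive zeros of a continuous function that also vanishes at 0 may accumulate there. Strict
  negativity of \<open>b_d\<close> near \<open>t = 0\<close> thus does more than bound the stepsize:
  it keeps the zeros away from 0. Both this negativity and the growth of \<open>b_d\<close> rest on
  a nonzero gradient at the current point, which the stopping test provides at every performed
  iteration. At \<open>t = 0\<close>, \<open>b_d\<close> equals \<open>C_ET\<close>, which is
  bounded by a form in \<open>(norm v)^2\<close> and \<open>(norm (g x))^2\<close> with coefficients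
  \<open>-(beta3 - a * beta1 - a^2 * beta5)\<close> and \<open>-(beta4 - a * beta2)\<close>. The
  threshold \<open>a2_star\<close> is \<open>alpha\<close> times the smaller of the positive zeros
  in \<open>a\<close> of the two brackets. That its formula yields the positive zero of the first
  bracket is derived from \<open>beta5 > 0\<close>, hence from \<open>mu \<le> L\<close>, which
  holds once the space has a point other than the minimizer.\<close>

section \<open>First positive zeros of continuous functions and of integrals\<close>

lemma first_positive_zero:
  fixes Q :: "real \<Rightarrow> real"
  assumes cont: "\<And>b. continuous_on {0..b} Q"
    and Q0: "Q 0 = 0" and m: "m > 0" and neg: "\<And>t. 0 < t \<Longrightarrow> t \<le> m \<Longrightarrow> Q t < 0"
    and T: "T > 0" "Q T \<ge> 0"
  defines "D \<equiv> (LEAST t. t > 0 \<and> Q t = 0)"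
  shows "m \<le> D" and "Q D = 0" and "\<And>t. 0 < t \<Longrightarrow> Q t = 0 \<Longrightarrow> D \<le> t"
    and "\<And>t. 0 \<le> t \<Longrightarrow> t \<le> D \<Longrightarrow> Q t \<le> 0"
proof -
  have root: "\<exists>z. m \<le> z \<and> z \<le> t \<and> Q z = 0" if "m \<le> t" "Q t \<ge> 0" for t
  proof -
    have "continuous_on {m..t} Q"
      by (rule continuous_on_subset[OF cont[of t]]) (use m in auto)
    then show ?thesis
      using IVT'[of Q m 0 t] neg[of m] m that by force
  qed
  have mT: "m \<le> T"
    using neg[of T] T by force
  \<comment> \<open>The set of all positive zeros need not be closed at 0; cutting it at
    \<open>m\<close> loses nothing because \<open>Q\<close> is negative on the part removed.\<close>
  define S where "S = {z \<in> {m..T}. Q z = 0}"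
  have "closed S" unfolding S_def
    by (intro continuous_closed_preimage_constant continuous_on_subset[OF cont[of T]]) (use m in auto)
  moreover have "bounded S"
    by (rule bounded_subset[of "{m..T}"]) (auto simp: S_def)
  ultimately have "compact S"
    by (simp add: compact_eq_bounded_closed)
  moreover have "S \<noteq> {}"
    using root[OF mT T(2)] by (auto simp: S_def)
  ultimately obtain z where z: "z \<in> S" and zmin: "\<And>y. y \<in> S \<Longrightarrow> z \<le> y"
    using compact_attains_inf[of S] by blast
  have min: "z \<le> t" if "t > 0" "Q t = 0" for t
  proof (rule ccontr)
    assume "\<not> z \<le> t"
    moreover have "m \<le> t"
      using neg[of t] that by force
    ultimately have "t \<in> S"
      using z that by (auto simp: S_def)
    with zmin \<open>\<not> z \<le> t\<close> show False by auto
  qed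
  have D: "D = z"
    unfolding D_def by (rule Least_equality) (use z m min in \<open>auto simp: S_def\<close>)
  show "m \<le> D" "Q D = 0" "\<And>t. 0 < t \<Longrightarrow> Q t = 0 \<Longrightarrow> D \<le> t"
    using z min by (auto simp: D S_def)
  show "Q t \<le> 0" if t: "0 \<le> t" "t \<le> D" for t
  proof (rule ccontr)
    assume pos: "\<not> Q t \<le> 0"
    with t Q0 have "m \<le> t"
      using neg[of t] by (cases "t = 0") force+
    with root[of t] pos obtain y where y: "m \<le> y" "y \<le> t" "Q y = 0" by auto
    with min[of y] m have "y = t" using t D by auto
    with y pos show False by simp
  qed
qed

text \<open>The signs of the integrand are enough: where \<open>h\<close> is negative the integral
  decreases strictly from 0, and where \<open>h\<close> is at least 1 it grows at least linearly and
  must become nonnegative.\<close>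

lemma first_positive_zero_integral:
  fixes h :: "real \<Rightarrow> real"
  assumes cont: "continuous_on UNIV h" and m: "m > 0"
    and neg: "\<And>t. 0 \<le> t \<Longrightarrow> t < m \<Longrightarrow> h t < 0"
    and T0: "T0 \<ge> 0" and large: "\<And>t. t \<ge> T0 \<Longrightarrow> h t \<ge> 1"
  defines "Q \<equiv> \<lambda>t. integral {0..t} h"
  defines "D \<equiv> (LEAST t. t > 0 \<and> Q t = 0)"
  shows "m \<le> D" and "Q D = 0" and "\<And>t. 0 < t \<Longrightarrow> Q t = 0 \<Longrightarrow> D \<le> t"
    and "\<And>t. 0 \<le> t \<Longrightarrow> t \<le> D \<Longrightarrow> Q t \<le> 0"
proof -
  have conth: "continuous_on {c..d} h" for c d
    using cont by (rule continuous_on_subset) auto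
  have int: "h integrable_on {c..d}" for c d
    by (rule integrable_continuous_real[OF conth])
  have contQ: "continuous_on {0..b} Q" for b
    unfolding Q_def by (rule indefinite_integral_continuous_1[OF int])
  have Q0: "Q 0 = 0" by (simp add: Q_def)
  \<comment> \<open>The case \<open>t = m\<close> is included although \<open>h\<close> is negative
    only before \<open>m\<close>: monotonicity needs the derivative in the open interval
    only.\<close>
  have negQ: "Q t < 0" if "0 < t" "t \<le> m" for t
  proof -
    have "\<exists>y. DERIV Q x :> y \<and> y < 0" if "0 < x" "x < t" for x
    proof -
      have "(Q has_real_derivative h x) (at x within {0..t})"
        unfolding Q_def using that by (intro integral_has_real_derivative conth) auto
      then have "DERIV Q x :> h x"
        using that by (simp add: at_within_Icc_at)
      with neg[of x] that \<open>t \<le> m\<close> show ?thesis by auto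
    qed
    from DERIV_neg_imp_decreasing_open[OF \<open>0 < t\<close> this contQ] show ?thesis
      by (simp add: Q0)
  qed
  \<comment> \<open>The interval from \<open>T0\<close> to \<open>T\<close> is long enough for an
    integrand of at least 1 to compensate any negative value \<open>Q T0\<close>.\<close>
  define T where "T = T0 + \<bar>Q T0\<bar> + 1"
  have "T - T0 = integral {T0..T} (\<lambda>_. 1)"
    by (simp add: T_def)
  also have "\<dots> \<le> integral {T0..T} h"
    by (rule integral_le) (use large int in auto)
  also have "\<dots> = Q T - Q T0"
    using Henstock_Kurzweil_Integration.integral_combine[OF T0 _ int, of T] by (simp add: Q_def T_def)
  finally have "Q T \<ge> 0" "T > 0"
    using T0 by (auto simp: T_def)
  note first_positive_zero[OF contQ Q0 m negQ this(2,1)]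
  then show "m \<le> D" and "Q D = 0" and "\<And>t. 0 < t \<Longrightarrow> Q t = 0 \<Longrightarrow> D \<le> t"
    and "\<And>t. 0 \<le> t \<Longrightarrow> t \<le> D \<Longrightarrow> Q t \<le> 0"
    by (simp_all add: D_def)
qed

lemma quadratic_eventually_ge:
  fixes c0 c1 c2 :: real
  assumes "c2 > 0"
  obtains T where "T \<ge> 0" and "\<And>t. t \<ge> T \<Longrightarrow> c2 * t\<^sup>2 + c1 * t + c0 \<ge> 1"
proof
  define T where "T = max 1 ((\<bar>c1\<bar> + \<bar>c0\<bar> + 1) / c2)"
  show "T \<ge> 0" by (simp add: T_def)
  show "c2 * t\<^sup>2 + c1 * t + c0 \<ge> 1" if "t \<ge> T" for t
  proof -
    have t: "t \<ge> 1" and "c2 * t \<ge> \<bar>c1\<bar> + \<bar>c0\<bar> + 1"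
      using that assms by (auto simp: T_def field_simps)
    then have "(c2 * t - \<bar>c1\<bar>) * t \<ge> (\<bar>c0\<bar> + 1) * 1"
      by (intro mult_mono) auto
    moreover have "c1 * t \<ge> - \<bar>c1\<bar> * t"
      using t by (intro mult_right_mono) auto
    ultimately show ?thesis
      by (simp add: power2_eq_square algebra_simps)
  qed
qed

section \<open>Inequalities for smooth strongly convex functions\<close>

locale smooth_strongly_convex =
  fixes f :: "'a::real_inner \<Rightarrow> real" and g :: "'a \<Rightarrow> 'a" and mu L :: real and xs :: 'a
  assumes mu_pos: "mu > 0" and L_pos: "L > 0"
    and grad: "GDERIV f x :> g x"
    and strong: "strongly_convex mu f g"
    and lipschitz: "L-lipschitz_on UNIV g"
    and minimizer: "f xs \<le> f y"
begin

lemma strong_lower_bound: "f y - f x \<ge> g x \<bullet> (y - x) + mu / 2 * (norm (y - x))\<^sup>2"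
  using strong by (auto simp: strongly_convex_def norm_minus_commute)

lemma norm_grad_diff: "norm (g x - g y) \<le> L * norm (x - y)"
  using lipschitz_on_normD[OF lipschitz] by auto

lemma inner_grad_diff: "(g (x + t *\<^sub>R v) - g x) \<bullet> v \<le> t * L * (norm v)\<^sup>2" if "t \<ge> 0"
proof -
  have "(g (x + t *\<^sub>R v) - g x) \<bullet> v \<le> norm (g (x + t *\<^sub>R v) - g x) * norm v"
    by (rule norm_cauchy_schwarz)
  also have "\<dots> \<le> L * norm (x + t *\<^sub>R v - x) * norm v"
    by (intro mult_right_mono norm_grad_diff) auto
  also have "\<dots> = t * L * (norm v)\<^sup>2"
    using that by (simp add: power2_eq_square)
  finally show ?thesis .
qed

lemma has_real_derivative_line:
  "((\<lambda>t. f (x + t *\<^sub>R v)) has_real_derivative g (x + t *\<^sub>R v) \<bullet> v) (at t)"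
proof -
  have "((\<lambda>t. x + t *\<^sub>R v) has_derivative (\<lambda>h. h *\<^sub>R v)) (at t)"
    by (auto intro!: derivative_eq_intros)
  from has_derivative_compose[OF this grad[unfolded gderiv_def]] show ?thesis
    by (simp add: has_field_derivative_def inner_commute mult_commute_abs)
qed

text \<open>The difference between \<open>f\<close> on the line and its quadratic upper model has a
  nonpositive derivative for nonnegative times, by \<open>inner_grad_diff\<close>.\<close>

lemma descent_line: "f (x + t *\<^sub>R v) - f x \<le> t * (g x \<bullet> v) + L / 2 * t\<^sup>2 * (norm v)\<^sup>2" if "t \<ge> 0"
proof -
  define p where "p = (\<lambda>t. f (x + t *\<^sub>R v) - t * (g x \<bullet> v) - L / 2 * t\<^sup>2 * (norm v)\<^sup>2)"
  have "(p has_real_derivative g (x + z *\<^sub>R v) \<bullet> v - g x \<bullet> v - z * L * (norm v)\<^sup>2) (at z)" for z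
    unfolding p_def by (auto intro!: derivative_eq_intros has_real_derivative_line)
  moreover have "g (x + z *\<^sub>R v) \<bullet> v - g x \<bullet> v - z * L * (norm v)\<^sup>2 \<le> 0" if "z \<ge> 0" for z
    using inner_grad_diff[OF that, of x v] by (simp add: inner_diff_left)
  ultimately have "p t \<le> p 0"
    using DERIV_nonpos_imp_nonincreasing[OF that, of p] by metis
  then show ?thesis by (simp add: p_def)
qed

lemma descent: "f y - f x \<le> g x \<bullet> (y - x) + L / 2 * (norm (y - x))\<^sup>2"
  using descent_line[of 1 x "y - x"] by simp

text \<open>The direction \<open>u\<close> is left free for two uses: \<open>g x\<close> at the
  point \<open>x\<close>, and \<open>- g x\<close> at the base point \<open>xs\<close>.\<close>

lemma descent_step: "f (x - (1 / L) *\<^sub>R u) \<le> f x - (g x \<bullet> u) / L + (norm u)\<^sup>2 / (2 * L)"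
  using descent[of "x - (1 / L) *\<^sub>R u" x] L_pos
  by (simp add: power_divide power2_eq_square field_simps)

text \<open>A gradient step of length \<open>1 / L\<close> lowers \<open>f\<close> by at least the
  right-hand side, yet cannot go below the minimum.\<close>

lemma gap_ge_grad: "f x - f xs \<ge> (norm (g x))\<^sup>2 / (2 * L)"
proof -
  have "f xs \<le> f x - (norm (g x))\<^sup>2 / L + (norm (g x))\<^sup>2 / (2 * L)"
    using descent_step[of x "g x"] minimizer[of "x - (1 / L) *\<^sub>R g x"]
    by (simp add: power2_norm_eq_inner)
  then show ?thesis using L_pos by (simp add: field_simps)
qed

lemma grad_minimizer: "g xs = 0"
  using gap_ge_grad[of xs] L_pos by (simp add: field_simps)

text \<open>Cocoercivity at the minimizer: add \<open>gap_ge_grad\<close> to the same bound for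
  \<open>z \<mapsto> f z - g x \<bullet> z\<close>, which is minimized at \<open>x\<close>.\<close>

lemma cocoercive: "(x - xs) \<bullet> g x \<ge> (norm (g x))\<^sup>2 / L"
proof -
  define z where "z = xs - (1 / L) *\<^sub>R (- g x)"
  have "f z \<le> f xs + (norm (g x))\<^sup>2 / (2 * L)"
    using descent_step[of xs "- g x"] by (simp add: z_def grad_minimizer)
  moreover have "f z - f x \<ge> g x \<bullet> (z - x)"
    using strong_lower_bound[of x z] mu_pos by (smt (verit) mult_nonneg_nonneg zero_le_power2 divide_nonneg_pos)
  moreover have "g x \<bullet> (z - x) = (norm (g x))\<^sup>2 / L - (x - xs) \<bullet> g x"
    by (simp add: z_def algebra_simps power2_norm_eq_inner inner_commute)
  ultimately show ?thesis
    using gap_ge_grad[of x] L_pos by (simp add: field_simps)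
qed

text \<open>Adding the strong convexity inequalities from \<open>x\<close> to \<open>xs\<close> and
  back gives strong monotonicity of the gradient; Cauchy-Schwarz does the rest.\<close>

lemma norm_grad_ge: "mu * norm (x - xs) \<le> norm (g x)"
proof (cases "x = xs")
  case False
  have "mu * (norm (x - xs))\<^sup>2 \<le> g x \<bullet> (x - xs)"
    using strong_lower_bound[of x xs] strong_lower_bound[of xs x]
    by (simp add: grad_minimizer norm_minus_commute inner_diff_right)
  also have "\<dots> \<le> norm (g x) * norm (x - xs)"
    by (rule norm_cauchy_schwarz)
  finally show ?thesis
    using False by (simp add: power2_eq_square)
qed (simp add: grad_minimizer)

lemma norm_grad_le: "norm (g x) \<le> L * norm (x - xs)"
  using norm_grad_diff[of x xs] by (simp add: grad_minimizer)

lemma mu_le_L: "mu \<le> L" if "x \<noteq> xs"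
  using order_trans[OF norm_grad_ge norm_grad_le, of x] that by simp

end

section \<open>Decay of the Lyapunov function along one step\<close>

locale heavy_ball = smooth_strongly_convex f g mu L xs
  for f :: "'a::real_inner \<Rightarrow> real" and g mu L xs +
  fixes s a :: real
  assumes s_pos: "s > 0" and a_nonneg: "a \<ge> 0"
begin

abbreviation q where "q \<equiv> sqmu mu s"

lemma q_pos: "q > 0" and sqrt_mu_pos: "sqrt mu > 0"
  using mu_pos s_pos by (auto simp: sqmu_def intro: add_pos_nonneg)

lemma mu_powr: "mu powr (3/2) = mu * sqrt mu"
proof -
  have "mu powr (3/2) = mu powr (1 + 1/2)" by simp
  also have "\<dots> = mu * sqrt mu"
    using mu_pos by (simp only: powr_add powr_half_sqrt powr_one)
  finally show ?thesis .
qed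

text \<open>The left-hand side is the value at \<open>t = 0\<close> of the derivative of
  \<open>V_lyap\<close> plus \<open>sqrt mu / 4\<close> times \<open>V_lyap\<close>. The point is to
  eliminate the unknown \<open>xs\<close>, by strong convexity between the displaced point and
  \<open>xs\<close>.\<close>

lemma constant_terms_le_C:
  fixes x v :: 'a
  defines "gh \<equiv> g (x + a *\<^sub>R v)" and "u \<equiv> v + (2 * sqrt mu) *\<^sub>R (x - xs)"
  shows "q * ((g x - gh) \<bullet> v) - sqrt mu * (norm v)\<^sup>2 - q * sqrt mu * ((x - xs) \<bullet> gh)
    + sqrt mu / 4 * (q * (f x - f xs) + (norm v)\<^sup>2 / 4 + (norm u)\<^sup>2 / 4)
    \<le> C_ET f g mu L s a (x, v)"
proof -
  define r d G G1 G2 where "r = sqrt mu" and "d = x - xs" and "G = norm (g x)"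
    and "G1 = G\<^sup>2 / L" and "G2 = G\<^sup>2 / L\<^sup>2"
  have r: "r > 0" "mu = r\<^sup>2"
    using mu_pos by (auto simp: r_def)
  have q: "q = 1 + r * sqrt s"
    by (simp add: sqmu_def r_def real_sqrt_mult)
  \<comment> \<open>Half of the parallelogram law. The coefficient of \<open>(norm v)^2\<close>
    becomes \<open>-1 + 1/16 + 2/16 = -13/16\<close> times \<open>r\<close>.\<close>
  have u: "(norm u)\<^sup>2 \<le> 2 * (norm v)\<^sup>2 + 8 * mu * (norm d)\<^sup>2"
  proof -
    have "0 \<le> (norm (v - (2 * r) *\<^sub>R d))\<^sup>2" by simp
    then show ?thesis
      using r(1) unfolding u_def r_def[symmetric] d_def[symmetric] r(2) power2_norm_eq_inner
      by (simp add: algebra_simps inner_commute power2_eq_square)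
  qed
  \<comment> \<open>The cross term of this lower bound has the unfavourable sign;
    \<open>norm_grad_ge\<close> then replaces \<open>mu * norm d\<close> in it by
    \<open>norm (g x)\<close>, which no longer involves \<open>xs\<close>.\<close>
  have "(norm (d + a *\<^sub>R v))\<^sup>2 \<ge> (norm d - norm (a *\<^sub>R v))\<^sup>2"
    using norm_triangle_ineq3[of d "- (a *\<^sub>R v)"]
    by (simp add: abs_le_square_iff[symmetric])
  then have "mu / 2 * (norm (d + a *\<^sub>R v))\<^sup>2 \<ge> mu / 2 * (norm d - norm (a *\<^sub>R v))\<^sup>2"
    using mu_pos by (intro mult_left_mono) auto
  then have "mu / 2 * (norm (d + a *\<^sub>R v))\<^sup>2
      \<ge> mu / 2 * (norm d)\<^sup>2 + mu / 2 * (norm (a *\<^sub>R v))\<^sup>2 - mu * norm d * norm (a *\<^sub>R v)"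
    by (simp add: power2_diff algebra_simps)
  moreover have "mu * norm d * norm (a *\<^sub>R v) \<le> G * norm (a *\<^sub>R v)"
    unfolding G_def d_def by (intro mult_right_mono norm_grad_ge) auto
  moreover have "f xs - f (x + a *\<^sub>R v) \<ge> - (d \<bullet> gh) - gh \<bullet> (a *\<^sub>R v)
      + mu / 2 * (norm (d + a *\<^sub>R v))\<^sup>2"
  proof -
    have eq: "xs - (x + a *\<^sub>R v) = - (d + a *\<^sub>R v)" by (simp add: d_def)
    show ?thesis
      using strong_lower_bound[of "x + a *\<^sub>R v" xs]
      unfolding eq norm_minus_cancel inner_minus_right
      by (simp add: gh_def inner_right_distrib inner_left_distrib inner_commute)
  qed
  ultimately have main: "- (d \<bullet> gh) \<le> gh \<bullet> (a *\<^sub>R v) + (f xs - f (x + a *\<^sub>R v))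
      - mu / 2 * (norm d)\<^sup>2 - mu / 2 * (norm (a *\<^sub>R v))\<^sup>2 + G * norm (a *\<^sub>R v)"
    by linarith
  \<comment> \<open>Splitting \<open>f xs - f (x + a v)\<close> at \<open>f x\<close> gives the gap
    \<open>f x - f xs\<close> the weight -1; the share 1/4 coming from \<open>V_lyap\<close> leaves
    -3/4.\<close>
  have gap: "3 / 4 * (f x - f xs) \<ge> 3 / 8 * G1"
    using gap_ge_grad[of x] L_pos by (simp add: G_def G1_def field_simps)
  have "(norm d)\<^sup>2 \<ge> G2"
    using power_mono[OF norm_grad_le[of x], of 2] L_pos
    by (simp add: G_def G2_def d_def power_mult_distrib field_simps)
  then have dd: "mu\<^sup>2 * sqrt s / 2 * (norm d)\<^sup>2 \<ge> mu\<^sup>2 * sqrt s / 2 * G2"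
    using s_pos by (intro mult_left_mono) auto
  have "q * r * (- (d \<bullet> gh)) \<le> q * r * (gh \<bullet> (a *\<^sub>R v) + (f xs - f (x + a *\<^sub>R v))
      - mu / 2 * (norm d)\<^sup>2 - mu / 2 * (norm (a *\<^sub>R v))\<^sup>2 + G * norm (a *\<^sub>R v))"
    using main q_pos r by (intro mult_left_mono) auto
  moreover have "q * r * (3 / 4 * (f x - f xs)) \<ge> q * r * (3 / 8 * G1)"
    using gap q_pos r by (intro mult_left_mono) auto
  moreover have "r / 16 * (norm u)\<^sup>2 \<le> r / 16 * (2 * (norm v)\<^sup>2 + 8 * mu * (norm d)\<^sup>2)"
    using u r by (intro mult_left_mono) auto
  \<comment> \<open>The strong convexity term exceeds the \<open>(norm d)^2\<close> part of
    \<open>u\<close> because \<open>q - 1 = r * sqrt s\<close>; this surplus produces the term with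
    \<open>sqrt s\<close> in \<open>C_ET\<close>.\<close>
  moreover have "q * r * (mu / 2 * (norm d)\<^sup>2) - r * mu / 2 * (norm d)\<^sup>2
      = mu\<^sup>2 * sqrt s / 2 * (norm d)\<^sup>2"
    unfolding q unfolding r(2) by (simp add: algebra_simps power2_eq_square)
  moreover have "C_ET f g mu L s a (x, v) = - (13 * r / 16) * (norm v)\<^sup>2 - mu\<^sup>2 * sqrt s / 2 * G2
      + q * (- (3 / 8) * (r * G1) + r * (f x - f (x + a *\<^sub>R v)) + r * G * norm (a *\<^sub>R v)
        - mu * r / 2 * (norm (a *\<^sub>R v))\<^sup>2 - (gh - g x) \<bullet> v + r * (gh \<bullet> (a *\<^sub>R v)))"
    by (simp add: C_ET_def Let_def mu_powr r_def gh_def G_def G1_def G2_def)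
  ultimately show ?thesis
    using dd unfolding r_def[symmetric] d_def[symmetric]
    by (simp add: algebra_simps add_divide_distrib inner_diff_left)
qed

text \<open>The direction is frozen along the step, so both squared norms are exact quadratics in
  \<open>t\<close>. While \<open>v\<close> moves along \<open>- w\<close>, the damping cancels in
  \<open>u\<close>, which moves along \<open>- q gh\<close> alone.\<close>

lemma V_lyap_along:
  fixes x v :: 'a
  defines "gh \<equiv> g (x + a *\<^sub>R v)" and "u \<equiv> v + (2 * sqrt mu) *\<^sub>R (x - xs)"
  defines "w \<equiv> (2 * sqrt mu) *\<^sub>R v + q *\<^sub>R gh"
  shows "V_lyap f xs mu s ((x, v) + t *\<^sub>R X_hb g mu s a (x, v)) =
    q * (f (x + t *\<^sub>R v) - f xs)
    + 1/4 * ((norm v)\<^sup>2 - 2 * t * (v \<bullet> w) + t\<^sup>2 * (norm w)\<^sup>2)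
    + 1/4 * ((norm u)\<^sup>2 - 2 * (q * t) * (u \<bullet> gh) + (q * t)\<^sup>2 * (norm gh)\<^sup>2)"
proof -
  have sq: "(norm (y - c *\<^sub>R z))\<^sup>2 = (norm y)\<^sup>2 - 2 * c * (y \<bullet> z) + c\<^sup>2 * (norm z)\<^sup>2"
    for y z :: 'a and c
    unfolding power2_norm_eq_inner by (simp add: algebra_simps inner_commute power2_eq_square)
  have 1: "v + t *\<^sub>R (- (2 * sqrt mu) *\<^sub>R v - q *\<^sub>R gh) = v - t *\<^sub>R w"
    by (simp add: w_def algebra_simps)
  have 2: "v - t *\<^sub>R w + (2 * sqrt mu) *\<^sub>R (x + t *\<^sub>R v - xs) = u - (q * t) *\<^sub>R gh"
    by (simp add: w_def u_def algebra_simps)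
  show ?thesis
    unfolding V_lyap_def X_hb_def gh_def[symmetric] prod.case scaleR_Pair add_Pair 1 2 sq by simp
qed

lemma V_lyap_decay:
  obtains D where
    "((\<lambda>t. V_lyap f xs mu s ((x, v) + t *\<^sub>R X_hb g mu s a (x, v))) has_real_derivative D) (at t)"
    "t \<ge> 0 \<Longrightarrow> D + sqrt mu / 4 * V_lyap f xs mu s ((x, v) + t *\<^sub>R X_hb g mu s a (x, v))
      \<le> b_d ET f g mu L s a (x, v) t"
proof
  define gh u r w where "gh = g (x + a *\<^sub>R v)" and "u = v + (2 * sqrt mu) *\<^sub>R (x - xs)"
    and "r = sqrt mu" and "w = (2 * sqrt mu) *\<^sub>R v + q *\<^sub>R gh"
  have r: "r > 0" "mu = r\<^sup>2"
    using mu_pos by (auto simp: r_def)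
  note along = V_lyap_along[of x v, folded gh_def, folded w_def u_def]
  define D where "D = q * (g (x + t *\<^sub>R v) \<bullet> v) + 1/4 * (- 2 * (v \<bullet> w) + 2 * t * (norm w)\<^sup>2)
    + 1/4 * (- 2 * q * (u \<bullet> gh) + 2 * (q * t) * q * (norm gh)\<^sup>2)"
  show "((\<lambda>t. V_lyap f xs mu s ((x, v) + t *\<^sub>R X_hb g mu s a (x, v))) has_real_derivative D) (at t)"
    unfolding along D_def
    by (auto intro!: derivative_eq_intros has_real_derivative_line simp: field_simps power2_eq_square)
  assume t: "t \<ge> 0"
  define K where "K = q * ((g x - gh) \<bullet> v) - r * (norm v)\<^sup>2 - q * r * ((x - xs) \<bullet> gh)
    + r / 4 * (q * (f x - f xs) + (norm v)\<^sup>2 / 4 + (norm u)\<^sup>2 / 4)"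
  \<comment> \<open>The slack of cocoercivity at the displaced point. With it the next relation is
    an exact identity, in which the slack carries a factor \<open>t\<close>; hence the assumption
    \<open>t \<ge> 0\<close>.\<close>
  define S where "S = (x + a *\<^sub>R v - xs) \<bullet> gh - (norm gh)\<^sup>2 / L"
  have "D + r / 4 * V_lyap f xs mu s ((x, v) + t *\<^sub>R X_hb g mu s a (x, v))
      = A_ET g mu s a (x, v) t + B_ET f g mu L s a (x, v) t + K - q * r\<^sup>2 * t / 4 * S"
    unfolding along D_def K_def S_def A_ET_def B_ET_def Let_def prod.case gh_def[symmetric]
      w_def u_def
    unfolding r_def[symmetric] power2_norm_eq_inner
    unfolding r(2)
    by (simp add: algebra_simps add_divide_distrib diff_divide_distrib inner_commute power2_eq_square)
  moreover have "q * r\<^sup>2 * t / 4 * S \<ge> 0"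
    using cocoercive[of "x + a *\<^sub>R v"] q_pos t by (simp add: S_def gh_def)
  moreover have "K \<le> C_ET f g mu L s a (x, v)"
    unfolding K_def r_def gh_def u_def by (rule constant_terms_le_C)
  ultimately show "D + sqrt mu / 4 * V_lyap f xs mu s ((x, v) + t *\<^sub>R X_hb g mu s a (x, v))
      \<le> b_d ET f g mu L s a (x, v) t"
    by (simp add: b_d_def r_def)
qed

text \<open>The difference is exactly the slack of the Lipschitz bound
  \<open>inner_grad_diff\<close> plus that of \<open>descent_line\<close>, each with a positive
  weight.\<close>

lemma b_d_ET_le_ST:
  assumes t: "t \<ge> 0"
  shows "b_d ET f g mu L s a p t \<le> b_d ST f g mu L s a p t"
proof -
  obtain x v where p: "p = (x, v)" by (cases p)
  define gh where "gh = g (x + a *\<^sub>R v)"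
  have "b_d ST f g mu L s a p t - b_d ET f g mu L s a p t =
      q * (t * L * (norm v)\<^sup>2 - (g (x + t *\<^sub>R v) - g x) \<bullet> v)
      + sqrt mu * q / 4 * (t * (g x \<bullet> v) + L / 2 * t\<^sup>2 * (norm v)\<^sup>2 - (f (x + t *\<^sub>R v) - f x))"
    unfolding p b_d_def trigger.case A_ET_def B_ET_def A_ST_def Bl_ST_def Bq_ST_def Let_def prod.case
      gh_def[symmetric]
    using mu_pos by (simp add: algebra_simps inner_commute power2_eq_square)
  moreover have "\<dots> \<ge> 0"
    using inner_grad_diff[OF t, of x v] descent_line[OF t, of x v] q_pos sqrt_mu_pos
    by (intro add_nonneg_nonneg mult_nonneg_nonneg) auto
  ultimately show ?thesis by simp
qed

lemma continuous_f_along: "continuous_on A (\<lambda>t. f (x + t *\<^sub>R v))"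
  by (rule DERIV_continuous_on[OF has_field_derivative_at_within[OF has_real_derivative_line]])

lemma continuous_g_along: "continuous_on A (\<lambda>t. g (x + t *\<^sub>R v))"
  by (rule continuous_on_compose2[OF lipschitz_on_continuous_on[OF lipschitz]])
    (auto intro!: continuous_intros)

lemma continuous_b_d: "continuous_on A (b_d tr f g mu L s a p)"
proof -
  obtain x v where p: "p = (x, v)" by (cases p)
  have "continuous_on A (\<lambda>t. b_d tr f g mu L s a p t)"
    by (cases tr; simp only: p b_d_def trigger.case A_ET_def B_ET_def Let_def prod.case)
      (use L_pos in \<open>auto intro!: continuous_intros continuous_f_along continuous_g_along\<close>)
  then show ?thesis .
qed

lemma V_lyap_le_b_p:
  assumes t: "t \<ge> 0"
  shows "V_lyap f xs mu s (p + t *\<^sub>R X_hb g mu s a p)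
    \<le> exp (- (sqrt mu / 4) * t) * (V_lyap f xs mu s p + b_p tr f g mu L s a p t)"
proof -
  obtain x v where p: "p = (x, v)" by (cases p)
  define V where "V = (\<lambda>t. V_lyap f xs mu s (p + t *\<^sub>R X_hb g mu s a p))"
  define c where "c = sqrt mu / 4"
  have "\<exists>D. (V has_real_derivative D) (at z) \<and> (z \<ge> 0 \<longrightarrow> D + c * V z \<le> b_d tr f g mu L s a p z)" for z
  proof -
    obtain D where "(V has_real_derivative D) (at z)"
      "z \<ge> 0 \<Longrightarrow> D + c * V z \<le> b_d ET f g mu L s a p z"
      using V_lyap_decay[of x v z] unfolding V_def p c_def by blast
    moreover have "b_d ET f g mu L s a p z \<le> b_d tr f g mu L s a p z" if "z \<ge> 0"
      using b_d_ET_le_ST[OF that] by (cases tr) auto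
    ultimately show ?thesis by force
  qed
  then obtain V' where V': "(V has_real_derivative V' z) (at z)"
    and decay: "z \<ge> 0 \<Longrightarrow> V' z + c * V z \<le> b_d tr f g mu L s a p z" for z
    by metis
  have "((\<lambda>z. exp (c * z) * V z) has_real_derivative exp (c * z) * (V' z + c * V z)) (at z)" for z
    by (auto intro!: derivative_eq_intros V' simp: algebra_simps)
  \<comment> \<open>The fundamental theorem supplies integrability of the derivative as well, so the
    two integrals can be compared without knowing that \<open>V'\<close> is continuous.\<close>
  then have "((\<lambda>z. exp (c * z) * (V' z + c * V z)) has_integral
      (exp (c * t) * V t - exp (c * 0) * V 0)) {0..t}"
    using t by (intro fundamental_theorem_of_calculus)
      (auto simp: has_real_derivative_iff_has_vector_derivative[symmetric]
        intro: has_field_derivative_at_within)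
  moreover have "((\<lambda>z. exp (c * z) * b_d tr f g mu L s a p z) has_integral
      b_p tr f g mu L s a p t) {0..t}"
    unfolding b_p_def c_def
    by (intro integrable_integral integrable_continuous_real continuous_intros continuous_b_d)
  ultimately have "exp (c * t) * V t - exp (c * 0) * V 0 \<le> b_p tr f g mu L s a p t"
    by (rule has_integral_le) (auto intro: decay)
  then have "exp (- c * t) * (exp (c * t) * V t) \<le> exp (- c * t) * (V 0 + b_p tr f g mu L s a p t)"
    by (intro mult_left_mono) auto
  then show ?thesis
    by (simp add: mult.assoc[symmetric] exp_add[symmetric]) (simp add: V_def c_def)
qed

text \<open>The quadratic coefficient could vanish only if \<open>v\<close> and \<open>gh\<close>
  both did; but \<open>v = 0\<close> makes \<open>gh\<close> equal to \<open>g x\<close>, which is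
  nonzero.\<close>

lemma b_d_eventually_ge:
  assumes "g (fst p) \<noteq> 0"
  obtains T where "T \<ge> 0" and "\<And>t. t \<ge> T \<Longrightarrow> b_d tr f g mu L s a p t \<ge> 1"
proof -
  obtain x v where p: "p = (x, v)" by (cases p)
  define gh where "gh = g (x + a *\<^sub>R v)"
  have nz: "gh \<noteq> 0" if "v = 0"
    using assms that by (auto simp: p gh_def)
  \<comment> \<open>One form serves both triggers: \<open>c = L\<close> gives \<open>Bq_ST\<close>,
    and \<open>c = mu\<close> gives the growth of \<open>b_d ET\<close> that strong convexity
    guarantees.\<close>
  define quad where "quad c = sqrt mu / 16 * (norm ((2 * sqrt mu) *\<^sub>R v + q *\<^sub>R gh))\<^sup>2
    + sqrt mu * q / 4 * (c / 2 * (norm v)\<^sup>2 + q / 4 * (norm gh)\<^sup>2)" for c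
  have quad_pos: "quad c > 0" if "c > 0" for c
  proof -
    have "c / 2 * (norm v)\<^sup>2 + q / 4 * (norm gh)\<^sup>2 > 0"
      using nz that q_pos by (cases "v = 0") (auto intro: add_pos_nonneg)
    then have "sqrt mu * q / 4 * (c / 2 * (norm v)\<^sup>2 + q / 4 * (norm gh)\<^sup>2) > 0"
      using q_pos sqrt_mu_pos by (intro mult_pos_pos[of "sqrt mu * q / 4"]) auto
    then show ?thesis
      using sqrt_mu_pos unfolding quad_def by (intro add_nonneg_pos) auto
  qed
  have "\<exists>c2>0. \<exists>c1 c0. \<forall>t\<ge>0. c2 * t\<^sup>2 + c1 * t + c0 \<le> b_d tr f g mu L s a p t"
  proof (cases tr)
    case ST
    have "Bq_ST g mu L s a p > 0"
      using quad_pos[OF L_pos] by (simp add: quad_def Bq_ST_def p gh_def Let_def)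
    then show ?thesis
      unfolding ST b_d_def trigger.case by blast
  next
    case ET
    \<comment> \<open>The linear coefficient left after \<open>f (x + t v) - f x\<close> is replaced
      by its strongly convex lower bound and the nonnegative gradient difference is dropped.\<close>
    define c1 where "c1 = 2 * mu * (norm v)\<^sup>2 + q * (2 * sqrt mu * (gh \<bullet> v) + q * (norm gh)\<^sup>2)
      - mu / 4 * (norm v)\<^sup>2 + sqrt mu * q / 4 * (g x \<bullet> v - v \<bullet> gh - sqrt mu / L * (norm gh)\<^sup>2
        + sqrt mu * ((a *\<^sub>R v) \<bullet> gh))"
    have "quad mu * t\<^sup>2 + c1 * t + C_ET f g mu L s a p \<le> b_d ET f g mu L s a p t" if t: "t \<ge> 0" for t
    proof -
      have "b_d ET f g mu L s a p t - (quad mu * t\<^sup>2 + c1 * t + C_ET f g mu L s a p) =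
          q * ((g (x + t *\<^sub>R v) - g x) \<bullet> v)
          + sqrt mu * q / 4 * (f (x + t *\<^sub>R v) - f x - t * (g x \<bullet> v) - mu / 2 * t\<^sup>2 * (norm v)\<^sup>2)"
        unfolding p b_d_def trigger.case A_ET_def B_ET_def c1_def quad_def Let_def prod.case
          gh_def[symmetric]
        using mu_pos by (simp add: algebra_simps inner_commute power2_eq_square)
      moreover have below: "f (x + t *\<^sub>R v) - f x \<ge> t * (g x \<bullet> v) + mu / 2 * t\<^sup>2 * (norm v)\<^sup>2"
        using strong_lower_bound[of x "x + t *\<^sub>R v"] by (simp add: power_mult_distrib)
      moreover have "(g (x + t *\<^sub>R v) - g x) \<bullet> v \<ge> 0"
      proof (cases "t = 0")
        case False
        have "0 \<le> mu / 2 * (norm (t *\<^sub>R v))\<^sup>2" using mu_pos by simp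
        then have "t * ((g (x + t *\<^sub>R v) - g x) \<bullet> v) \<ge> 0"
          using strong_lower_bound[of x "x + t *\<^sub>R v"] strong_lower_bound[of "x + t *\<^sub>R v" x]
          by (simp add: inner_diff_left algebra_simps)
        then show ?thesis
          using t False by (simp add: zero_le_mult_iff)
      qed simp
      moreover have "q * ((g (x + t *\<^sub>R v) - g x) \<bullet> v)
          + sqrt mu * q / 4 * (f (x + t *\<^sub>R v) - f x - t * (g x \<bullet> v) - mu / 2 * t\<^sup>2 * (norm v)\<^sup>2) \<ge> 0"
        using calculation(2,3) q_pos sqrt_mu_pos by (intro add_nonneg_nonneg mult_nonneg_nonneg) auto
      ultimately show ?thesis by linarith
    qed
    with quad_pos[OF mu_pos] show ?thesis
      unfolding ET by blast
  qed
  then obtain c2 c1 c0 where c2: "c2 > 0"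
    and ge: "\<And>t. t \<ge> 0 \<Longrightarrow> c2 * t\<^sup>2 + c1 * t + c0 \<le> b_d tr f g mu L s a p t"
    by blast
  obtain T where "T \<ge> 0" "\<And>t. t \<ge> T \<Longrightarrow> c2 * t\<^sup>2 + c1 * t + c0 \<ge> 1"
    using quadratic_eventually_ge[OF c2] by metis
  with ge that[of T] show ?thesis by (meson order_trans)
qed

section \<open>Bounds on the coefficients and the constants of MIET\<close>

text \<open>The denominators of \<open>eta1\<close> and \<open>nu1\<close> are built from
  \<open>K\<close>, which is, up to \<open>sqrt mu / 8\<close>, the coefficient of
  \<open>(norm v)^2\<close> in the bound on \<open>Bq_ST\<close>.\<close>

abbreviation K where "K \<equiv> q * L * (3 * a\<^sup>2 * q * L + 1) + 4 * mu"

lemma K_pos: "K > 0"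
  using mu_pos L_pos q_pos by (intro add_nonneg_pos mult_nonneg_nonneg) auto

context
  fixes x v :: 'a
begin

private abbreviation gh where "gh \<equiv> g (x + a *\<^sub>R v)"

text \<open>Serves to express every bound through \<open>norm v\<close> and
  \<open>norm (g x)\<close> alone, without the gradient at the displaced point.\<close>

lemma norm_grad_displaced: "(norm gh)\<^sup>2 \<le> 2 * (norm (g x))\<^sup>2 + 2 * L\<^sup>2 * a\<^sup>2 * (norm v)\<^sup>2"
proof -
  have "norm gh \<le> norm (g x) + norm (gh - g x)"
    by (rule norm_triangle_sub)
  also have "norm (gh - g x) \<le> L * (a * norm v)"
    using norm_grad_diff[of "x + a *\<^sub>R v" x] a_nonneg by simp
  finally have "(norm gh)\<^sup>2 \<le> (norm (g x) + L * (a * norm v))\<^sup>2"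
    by (intro power_mono) auto
  also have "\<dots> \<le> 2 * (norm (g x))\<^sup>2 + 2 * (L * (a * norm v))\<^sup>2"
    using sum_squares_bound[of "norm (g x)" "L * (a * norm v)"] by (simp add: power2_sum)
  finally show ?thesis by (simp add: power_mult_distrib mult_ac)
qed

lemma inner_grad_displaced: "gh \<bullet> v \<le> ((norm gh)\<^sup>2 + (norm v)\<^sup>2) / 2"
  using norm_cauchy_schwarz[of gh v] sum_squares_bound[of "norm gh" "norm v"]
  by (simp add: field_simps)

lemma inner_grad_displaced_diff: "\<bar>(gh - g x) \<bullet> v\<bar> \<le> a * L * (norm v)\<^sup>2"
proof -
  have "\<bar>(gh - g x) \<bullet> v\<bar> \<le> norm (gh - g x) * norm v"
    by (rule Cauchy_Schwarz_ineq2)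
  also have "\<dots> \<le> (L * (a * norm v)) * norm v"
    using norm_grad_diff[of "x + a *\<^sub>R v" x] a_nonneg by (intro mult_right_mono) auto
  finally show ?thesis by (simp add: power2_eq_square mult_ac)
qed

text \<open>Strong convexity at \<open>x\<close> bounds \<open>f x - f (x + a v)\<close>, and its
  first-order term cancels against that of the inner product of \<open>gh\<close> with
  \<open>a v\<close>; what remains is quadratic.\<close>

lemma C_le:
  "C_ET f g mu L s a (x, v)
    \<le> - (beta3 mu - a * beta1 mu L s - a\<^sup>2 * beta5 mu L s) * (norm v)\<^sup>2
      - (beta4 mu L s - a * beta2 mu s) * (norm (g x))\<^sup>2"
proof -
  define r n G where "r = sqrt mu" and "n = norm v" and "G = norm (g x)"
  have r: "r > 0" using mu_pos by (simp add: r_def)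
  have gx: "gh \<bullet> (a *\<^sub>R v) \<le> a * (g x \<bullet> v) + a\<^sup>2 * L * n\<^sup>2"
  proof -
    have "a * ((gh - g x) \<bullet> v) \<le> a * (a * L * n\<^sup>2)"
      using inner_grad_displaced_diff a_nonneg unfolding n_def by (intro mult_left_mono) auto
    then show ?thesis by (simp add: inner_diff_left algebra_simps power2_eq_square)
  qed
  moreover have "f x - f (x + a *\<^sub>R v) \<le> - a * (g x \<bullet> v) - mu / 2 * a\<^sup>2 * n\<^sup>2"
    using strong_lower_bound[of x "x + a *\<^sub>R v"] by (simp add: n_def power_mult_distrib)
  ultimately have "r * (f x - f (x + a *\<^sub>R v) + gh \<bullet> (a *\<^sub>R v)) \<le> r * (a\<^sup>2 * L * n\<^sup>2 - mu / 2 * a\<^sup>2 * n\<^sup>2)"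
    using r by (intro mult_left_mono) auto
  moreover have "r * a * (G * n) \<le> r * a * ((G\<^sup>2 + n\<^sup>2) / 2)"
    using sum_squares_bound[of G n] r a_nonneg by (intro mult_left_mono) auto
  moreover have "- ((gh - g x) \<bullet> v) \<le> a * L * n\<^sup>2"
    using inner_grad_displaced_diff by (simp add: n_def)
  \<comment> \<open>The estimates so far are sharper than needed; these terms fill them up to the
    coefficients 3/2 and 5/2 of the \<open>beta\<close> constants.\<close>
  moreover have "0 \<le> r * a * (G\<^sup>2 + n\<^sup>2)" "0 \<le> r * a\<^sup>2 * L * n\<^sup>2" "0 \<le> mu * r * a\<^sup>2 * n\<^sup>2"
    using r a_nonneg L_pos mu_pos by auto
  ultimately have
    "r * (f x - f (x + a *\<^sub>R v)) + r * G * (a * n) - mu * r / 2 * (a * n)\<^sup>2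
        - (gh - g x) \<bullet> v + r * (gh \<bullet> (a *\<^sub>R v))
      \<le> 3/2 * r * a * (G\<^sup>2 + n\<^sup>2) + a * L * n\<^sup>2 + a\<^sup>2 * (5/2 * r * L - mu * r / 2) * n\<^sup>2"
    by (simp add: algebra_simps add_divide_distrib power_mult_distrib)
  from mult_left_mono[OF this, of q] q_pos
  have "q * (r * (f x - f (x + a *\<^sub>R v)) + r * G * (a * n) - mu * r / 2 * (a * n)\<^sup>2
        - (gh - g x) \<bullet> v + r * (gh \<bullet> (a *\<^sub>R v)))
      \<le> q * (3/2 * r * a * (G\<^sup>2 + n\<^sup>2) + a * L * n\<^sup>2 + a\<^sup>2 * (5/2 * r * L - mu * r / 2) * n\<^sup>2)"
    by simp
  moreover have "norm (a *\<^sub>R v) = a * n"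
    using a_nonneg by (simp add: n_def)
  moreover have "(beta4 mu L s) * G\<^sup>2 = mu\<^sup>2 * sqrt s / 2 * (G\<^sup>2 / L\<^sup>2) + q * (3 * r / (8 * L)) * G\<^sup>2"
    using L_pos by (simp add: beta4_def r_def field_simps power2_eq_square)
  ultimately show ?thesis
    unfolding C_ET_def Let_def prod.case mu_powr beta1_def beta2_def beta3_def beta5_def
      r_def[symmetric] G_def[symmetric] n_def[symmetric]
    by (simp add: algebra_simps add_divide_distrib)
qed

lemma Bq_le:
  "Bq_ST g mu L s a (x, v) \<le> sqrt mu * K / 8 * (norm v)\<^sup>2 + 3 * sqrt mu * q\<^sup>2 / 8 * (norm (g x))\<^sup>2"
proof -
  define r where "r = sqrt mu"
  have r: "r > 0" "r\<^sup>2 = mu" using mu_pos by (auto simp: r_def)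
  have "(norm ((2 * r) *\<^sub>R v + q *\<^sub>R gh))\<^sup>2 \<le> 8 * r\<^sup>2 * (norm v)\<^sup>2 + 2 * q\<^sup>2 * (norm gh)\<^sup>2"
  proof -
    have "0 \<le> (norm ((2 * r) *\<^sub>R v - q *\<^sub>R gh))\<^sup>2" by simp
    then show ?thesis
      unfolding power2_norm_eq_inner by (simp add: algebra_simps inner_commute power2_eq_square)
  qed
  then have "r / 16 * (norm ((2 * r) *\<^sub>R v + q *\<^sub>R gh))\<^sup>2
      \<le> r / 16 * (8 * mu * (norm v)\<^sup>2 + 2 * q\<^sup>2 * (norm gh)\<^sup>2)"
    using r by (intro mult_left_mono) auto
  \<comment> \<open>Of the 3/16, 2/16 come from splitting the squared norm and 1/16 from the last
    term of \<open>Bq_ST\<close>.\<close>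
  moreover have "3 * r * q\<^sup>2 / 16 * (norm gh)\<^sup>2
      \<le> 3 * r * q\<^sup>2 / 16 * (2 * (norm (g x))\<^sup>2 + 2 * L\<^sup>2 * a\<^sup>2 * (norm v)\<^sup>2)"
    using r norm_grad_displaced by (intro mult_left_mono) auto
  ultimately show ?thesis
    unfolding Bq_ST_def Let_def prod.case r_def[symmetric]
    by (simp add: algebra_simps add_divide_distrib power2_eq_square)
qed

lemma A_plus_Bl_le:
  "A_ST g mu L s a (x, v) + Bl_ST g mu L s a (x, v)
    \<le> 2 * nu1 mu L s a * (sqrt mu * K / 8) * (norm v)\<^sup>2
      + 2 * nu2 mu s a * (3 * sqrt mu * q\<^sup>2 / 8) * (norm (g x))\<^sup>2"
proof -
  define r n G where "r = sqrt mu" and "n = norm v" and "G = norm (g x)"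
  have r: "r > 0" "r * r = mu" using mu_pos by (auto simp: r_def)
  have nu1: "2 * nu1 mu L s a * (r * K / 8)
      = 2 * mu + q * L + r * q + q * r * (2 * a\<^sup>2 * L\<^sup>2) + q\<^sup>2 * (2 * a\<^sup>2 * L\<^sup>2)
        + r * q * a * L / 4 + mu * q * a / 8 * (1 + 2 * a\<^sup>2 * L\<^sup>2)"
  proof -
    define k where "k = K"
    define N M where "N = mu * (2 * a^3 * q * L\<^sup>2 + a * q + 16) + 8 * q * L * (2 * a\<^sup>2 * q * L + 1)"
      and "M = q * (a * L * (8 * a * L + 1) + 4)"
    have k: "k > 0" using K_pos by (simp add: k_def)
    have "nu1 mu L s a = N / (2 * r * k) + M / k"
      by (simp add: nu1_def N_def M_def k_def r_def)
    then have "2 * nu1 mu L s a * (r * k / 8) = N / 8 + r * M / 4"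
      using k r(1) by (simp add: field_simps)
    then show ?thesis
      unfolding k_def N_def M_def
      by (simp add: algebra_simps add_divide_distrib power2_eq_square power3_eq_cube)
  qed
  have nu2: "2 * nu2 mu s a * (3 * r * q\<^sup>2 / 8) = 2 * q * r + 2 * q\<^sup>2 + mu * q * a / 4"
    unfolding nu2_def r_def[symmetric] using q_pos r(1) by (simp add: field_simps power2_eq_square)
  define G1 where "G1 = (norm gh)\<^sup>2 / L"
  have gg: "(norm gh)\<^sup>2 \<le> 2 * G\<^sup>2 + 2 * L\<^sup>2 * a\<^sup>2 * n\<^sup>2"
    using norm_grad_displaced by (simp add: G_def n_def)
  have "2 * q * r * (gh \<bullet> v) \<le> 2 * q * r * (((norm gh)\<^sup>2 + n\<^sup>2) / 2)"
    using inner_grad_displaced q_pos r by (intro mult_left_mono) (auto simp: n_def)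
  moreover have "mu * q * a / 4 * (gh \<bullet> v) \<le> mu * q * a / 4 * (((norm gh)\<^sup>2 + n\<^sup>2) / 2)"
    using inner_grad_displaced q_pos mu_pos a_nonneg by (intro mult_left_mono) (auto simp: n_def)
  moreover have "(q * r + q\<^sup>2 + mu * q * a / 8) * (norm gh)\<^sup>2
      \<le> (q * r + q\<^sup>2 + mu * q * a / 8) * (2 * G\<^sup>2 + 2 * L\<^sup>2 * a\<^sup>2 * n\<^sup>2)"
    using gg q_pos r(1) mu_pos a_nonneg by (intro mult_left_mono) auto
  moreover have "r * q / 4 * ((g x - gh) \<bullet> v) \<le> r * q / 4 * (a * L * n\<^sup>2)"
    using inner_grad_displaced_diff q_pos r(1)
    by (intro mult_left_mono) (auto simp: n_def inner_diff_left)
  \<comment> \<open>These allow the two negative terms of \<open>Bl_ST\<close>, in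
    \<open>(norm v)^2\<close> and \<open>(norm gh)^2\<close>, to be discarded.\<close>
  moreover have "0 \<le> mu * n\<^sup>2" "0 \<le> mu * q * G1"
    using mu_pos L_pos q_pos by (auto simp: G1_def)
  moreover have "A_ST g mu L s a (x, v) + Bl_ST g mu L s a (x, v)
      = 2 * mu * n\<^sup>2 + q * L * n\<^sup>2 + 2 * q * r * (gh \<bullet> v) + q\<^sup>2 * (norm gh)\<^sup>2
        - mu * n\<^sup>2 / 4 + r * q / 4 * ((g x - gh) \<bullet> v) - mu * q * G1 / 4
        + mu * q * a / 4 * (gh \<bullet> v)"
    unfolding A_ST_def Bl_ST_def Let_def prod.case r_def[symmetric] n_def[symmetric] G1_def r(2)[symmetric]
    using r(1) by (simp add: algebra_simps inner_commute power2_eq_square)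
  ultimately show ?thesis
    unfolding r_def[symmetric] n_def[symmetric] G_def[symmetric] nu1 nu2
    by (simp add: algebra_simps add_divide_distrib)
qed

end

text \<open>Ties the sign of \<open>eta1\<close> to the quadratic in \<open>a\<close> whose positive
  root enters \<open>a2_star\<close>.\<close>

lemma eta1_scaled:
  "sqrt mu * K / 8 * eta1 mu L s a = beta3 mu - a * beta1 mu L s - a\<^sup>2 * beta5 mu L s"
proof -
  define r k where "r = sqrt mu" and "k = K"
  have r: "r > 0" and k: "k > 0" using mu_pos K_pos by (simp_all add: r_def k_def)
  have "eta1 mu L s a = (8 * a * q * (a * (mu - 5 * L) - 2 * L / r - 3) + 13) / (2 * k)"
    by (simp add: eta1_def r_def k_def algebra_simps)
  then have "r * k / 8 * eta1 mu L s a = r * (8 * a * q * (a * (mu - 5 * L) - 2 * L / r - 3) + 13) / 16"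
    using k by simp
  also have "\<dots> = beta3 mu - a * beta1 mu L s - a\<^sup>2 * beta5 mu L s"
    unfolding beta1_def beta3_def beta5_def mu_powr r_def[symmetric]
    using r by (simp add: field_simps power2_eq_square)
  finally show ?thesis by (simp add: r_def k_def)
qed

lemma eta2_scaled: "3 * sqrt mu * q\<^sup>2 / 8 * eta2 mu L s a = beta4 mu L s - a * beta2 mu s"
  unfolding eta2_def beta4_def beta2_def
  using L_pos q_pos sqrt_mu_pos by (simp add: field_simps power2_eq_square)

abbreviation "eta \<equiv> min (eta1 mu L s a) (eta2 mu L s a)"

abbreviation "nu \<equiv> max (nu1 mu L s a) (nu2 mu s a)"

text \<open>The constants of the paper are the ratios of the bounds \<open>Bq_le\<close>, \<open>A_plus_Bl_le\<close> and \<open>C_le\<close>,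
  taken separately for the coefficients of \<open>(norm v)\<^sup>2\<close> (giving \<open>nu1\<close>, \<open>eta1\<close>) and of
  \<open>(norm (g x))\<^sup>2\<close> (giving \<open>nu2\<close>, \<open>eta2\<close>); \<open>MIET\<close> is the positive root of the quadratic below.\<close>

lemma b_d_le_quadratic:
  assumes t: "t \<ge> 0"
  shows "b_d tr f g mu L s a p t
    \<le> (sqrt mu * K / 8 * (norm (snd p))\<^sup>2 + 3 * sqrt mu * q\<^sup>2 / 8 * (norm (g (fst p)))\<^sup>2)
      * (t\<^sup>2 + 2 * nu * t - eta)"
proof -
  obtain x v where p: "p = (x, v)" by (cases p)
  define cv cg where "cv = sqrt mu * K / 8 * (norm v)\<^sup>2"
    and "cg = 3 * sqrt mu * q\<^sup>2 / 8 * (norm (g x))\<^sup>2"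
  have nonneg: "cv \<ge> 0" "cg \<ge> 0"
    using K_pos sqrt_mu_pos unfolding cv_def cg_def
    by (intro mult_nonneg_nonneg divide_nonneg_pos; simp)+
  have "b_d tr f g mu L s a p t \<le> b_d ST f g mu L s a p t"
    using b_d_ET_le_ST[OF t] by (cases tr) auto
  also have "\<dots> \<le> (cv + cg) * t\<^sup>2 + (2 * nu1 mu L s a * cv + 2 * nu2 mu s a * cg) * t
      - (eta1 mu L s a * cv + eta2 mu L s a * cg)"
  proof -
    have "Bq_ST g mu L s a p * t\<^sup>2 \<le> (cv + cg) * t\<^sup>2"
      using Bq_le unfolding p cv_def cg_def by (rule mult_right_mono) simp
    moreover have "(A_ST g mu L s a p + Bl_ST g mu L s a p) * t
        \<le> (2 * nu1 mu L s a * cv + 2 * nu2 mu s a * cg) * t"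
      using A_plus_Bl_le t unfolding p cv_def cg_def mult.assoc by (rule mult_right_mono)
    moreover have "C_ET f g mu L s a p \<le> - (eta1 mu L s a * cv + eta2 mu L s a * cg)"
      using C_le[of x v] unfolding p eta1_scaled[symmetric] eta2_scaled[symmetric] cv_def cg_def
      by (simp add: mult_ac)
    ultimately show ?thesis
      by (simp add: b_d_def)
  qed
  also have "\<dots> = cv * (t\<^sup>2 + 2 * nu1 mu L s a * t - eta1 mu L s a)
      + cg * (t\<^sup>2 + 2 * nu2 mu s a * t - eta2 mu L s a)"
    by (simp add: algebra_simps)
  also have "\<dots> \<le> cv * (t\<^sup>2 + 2 * nu * t - eta) + cg * (t\<^sup>2 + 2 * nu * t - eta)"
    using t nonneg by (intro add_mono mult_left_mono diff_mono mult_right_mono) auto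
  finally show ?thesis
    by (simp add: p cv_def cg_def distrib_right)
qed

lemma nu_nonneg: "nu \<ge> 0"
proof -
  have "nu2 mu s a \<ge> 0"
    unfolding nu2_def using mu_pos a_nonneg q_pos by (intro divide_nonneg_pos) auto
  then show ?thesis by simp
qed

lemma eta_pos:
  assumes alpha: "0 < alpha" "alpha < 1" and a: "a \<le> a2_star alpha mu L s" and mu_L: "mu \<le> L"
  shows "eta > 0"
proof -
  define b1 b3 b5 where "b1 = beta1 mu L s" and "b3 = beta3 mu" and "b5 = beta5 mu L s"
  have b1: "b1 \<ge> 0" using q_pos mu_pos L_pos by (simp add: b1_def beta1_def)
  have b3: "b3 > 0" using mu_pos by (simp add: b3_def beta3_def)
  have b5: "b5 > 0"
  proof -
    have "sqrt mu * mu < 5 * (sqrt mu * L)"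
      using mu_L L_pos sqrt_mu_pos by simp
    then show ?thesis
      using q_pos by (simp add: b5_def beta5_def mu_powr mult_ac)
  qed
  have b4: "beta4 mu L s > 0" and b2: "beta2 mu s > 0"
    using mu_pos L_pos s_pos q_pos sqrt_mu_pos
    by (auto simp: beta4_def beta2_def intro!: divide_pos_pos add_pos_pos mult_pos_pos)
  \<comment> \<open>The positive root of \<open>b5 z^2 + b1 z = b3\<close>; below it
    \<open>eta1\<close> is positive.\<close>
  define rho where "rho = (- b1 + sqrt (b1\<^sup>2 + 4 * b5 * b3)) / (2 * b5)"
  have "b1 < sqrt (b1\<^sup>2 + 4 * b5 * b3)"
    using b3 b5 by (intro real_less_rsqrt) simp
  then have rho: "rho > 0"
    using b5 by (simp add: rho_def)
  have root: "b5 * rho\<^sup>2 + b1 * rho = b3"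
  proof -
    define S where "S = sqrt (b1\<^sup>2 + 4 * b5 * b3)"
    have S: "S * S = b1 * b1 + 4 * b5 * b3"
      using b3 b5 by (simp add: S_def power2_eq_square)
    have "b5 * rho\<^sup>2 + b1 * rho = (S * S - b1 * b1) / (4 * b5)"
      unfolding rho_def S_def[symmetric] using b5 by (simp add: field_simps power2_eq_square)
    then show ?thesis using b5 by (simp add: S)
  qed
  \<comment> \<open>The factor \<open>alpha < 1\<close> makes the inequality strict even for
    \<open>a\<close> equal to \<open>a2_star\<close>.\<close>
  have lt: "a < z" if "min rho (beta4 mu L s / beta2 mu s) \<le> z" "0 < z" for z
  proof -
    have "a \<le> alpha * min rho (beta4 mu L s / beta2 mu s)"
      using a by (simp add: a2_star_def rho_def b1_def b3_def b5_def)
    also have "\<dots> \<le> alpha * z"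
      using that(1) alpha(1) by (intro mult_left_mono) auto
    also have "\<dots> < z"
      using that(2) alpha(2) by simp
    finally show ?thesis .
  qed
  have "a < rho" "a < beta4 mu L s / beta2 mu s"
    using lt[of rho] lt[of "beta4 mu L s / beta2 mu s"] rho b2 b4 by auto
  then have "a * beta2 mu s < beta4 mu L s"
    using b2 by (simp add: field_simps)
  then have "eta2 mu L s a > 0"
    using eta2_scaled q_pos sqrt_mu_pos
    by (metis diff_gt_0_iff_gt divide_pos_pos mult_pos_pos zero_less_mult_pos zero_less_numeral zero_less_power)
  moreover have "eta1 mu L s a > 0"
  proof -
    have "b5 * a\<^sup>2 < b5 * rho\<^sup>2"
      using \<open>a < rho\<close> a_nonneg b5 by (intro mult_strict_left_mono power_strict_mono) auto
    moreover have "b1 * a \<le> b1 * rho"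
      using \<open>a < rho\<close> b1 by (intro mult_left_mono) auto
    ultimately have "beta3 mu - a * beta1 mu L s - a\<^sup>2 * beta5 mu L s > 0"
      using root by (simp add: b1_def b3_def b5_def mult_ac)
    then have "0 < sqrt mu * K / 8 * eta1 mu L s a"
      by (simp only: eta1_scaled)
    moreover have "0 < sqrt mu * K / 8"
      using K_pos sqrt_mu_pos by (intro divide_pos_pos mult_pos_pos) auto
    ultimately show ?thesis
      by (rule zero_less_mult_pos)
  qed
  ultimately show ?thesis by simp
qed

section \<open>Properties of the stepsize\<close>

lemma MIET_eq: "MIET mu L s a = - nu + sqrt (nu\<^sup>2 + eta)"
  by (simp add: MIET_def Let_def)

lemma MIET_pos:
  assumes "eta > 0"
  shows "MIET mu L s a > 0"
proof -
  have "nu < sqrt (nu\<^sup>2 + eta)"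
    using assms by (intro real_less_rsqrt) simp
  then show ?thesis by (simp only: MIET_eq)
qed

lemma b_d_neg:
  assumes nz: "g (fst p) \<noteq> 0" and t: "0 \<le> t" "t < MIET mu L s a"
  shows "b_d tr f g mu L s a p t < 0"
proof -
  \<comment> \<open>Completing the square; \<open>nu \<ge> 0\<close> is what identifies the square
    root of \<open>(t + nu)^2\<close> with \<open>t + nu\<close>.\<close>
  have "(t + nu)\<^sup>2 < nu\<^sup>2 + eta"
  proof -
    have "sqrt ((t + nu)\<^sup>2) < sqrt (nu\<^sup>2 + eta)"
      using t nu_nonneg by (simp only: MIET_eq real_sqrt_abs)
    then show ?thesis by (simp only: real_sqrt_less_iff)
  qed
  moreover have "t\<^sup>2 + 2 * n * t - e < 0" if "(t + n)\<^sup>2 < n\<^sup>2 + e" for n e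
    using that by (simp add: power2_sum algebra_simps)
  ultimately have "t\<^sup>2 + 2 * nu * t - eta < 0"
    by blast
  moreover have "sqrt mu * K / 8 * (norm (snd p))\<^sup>2 + 3 * sqrt mu * q\<^sup>2 / 8 * (norm (g (fst p)))\<^sup>2 > 0"
    using nz K_pos q_pos sqrt_mu_pos
    by (intro add_nonneg_pos mult_nonneg_nonneg mult_pos_pos divide_nonneg_pos divide_pos_pos) auto
  ultimately show ?thesis
    using b_d_le_quadratic[OF t(1), of tr p] by (meson mult_pos_neg order_le_less_trans)
qed

lemma step_p_properties:
  fixes tr :: trigger
  assumes nz: "g (fst p) \<noteq> 0" and eta: "eta > 0"
  defines "D \<equiv> step_p tr f g mu L s a p"
  shows "MIET mu L s a \<le> D" and "b_p tr f g mu L s a p D = 0"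
    and "\<And>t. 0 < t \<Longrightarrow> b_p tr f g mu L s a p t = 0 \<Longrightarrow> D \<le> t"
    and "\<And>t. 0 \<le> t \<Longrightarrow> t \<le> D \<Longrightarrow> b_p tr f g mu L s a p t \<le> 0"
proof -
  define h where "h = (\<lambda>z. exp (sqrt mu / 4 * z) * b_d tr f g mu L s a p z)"
  obtain T where T: "T \<ge> 0" and large: "\<And>t. t \<ge> T \<Longrightarrow> b_d tr f g mu L s a p t \<ge> 1"
    using b_d_eventually_ge[OF nz] by metis
  have cont: "continuous_on UNIV h"
    unfolding h_def by (intro continuous_intros continuous_b_d)
  have neg: "h t < 0" if "0 \<le> t" "t < MIET mu L s a" for t
    using b_d_neg[OF nz that] by (simp add: h_def mult_pos_neg)
  \<comment> \<open>The exponential weight is at least 1 because \<open>T\<close> is nonnegative, so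
    it preserves the lower bound on \<open>b_d\<close>.\<close>
  have ge1: "h t \<ge> 1" if "t \<ge> T" for t
  proof -
    have "exp (sqrt mu / 4 * t) \<ge> 1"
      using that T sqrt_mu_pos by simp
    then show ?thesis
      using large[OF that] mult_mono[of 1 "exp (sqrt mu / 4 * t)" 1 "b_d tr f g mu L s a p t"]
      by (simp add: h_def)
  qed
  have b_p: "b_p tr f g mu L s a p = (\<lambda>t. integral {0..t} h)"
    by (simp add: b_p_def h_def fun_eq_iff)
  note first_positive_zero_integral[OF cont MIET_pos[OF eta] neg T ge1]
  then show "MIET mu L s a \<le> D" and "b_p tr f g mu L s a p D = 0"
    and "\<And>t. 0 < t \<Longrightarrow> b_p tr f g mu L s a p t = 0 \<Longrightarrow> D \<le> t"
    and "\<And>t. 0 \<le> t \<Longrightarrow> t \<le> D \<Longrightarrow> b_p tr f g mu L s a p t \<le> 0"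
    by (simp_all add: D_def step_p_def b_p)
qed

lemma V_lyap_step:
  assumes "g (fst p) \<noteq> 0" and "eta > 0" and "0 \<le> t" "t \<le> step_p tr f g mu L s a p"
  shows "V_lyap f xs mu s (p + t *\<^sub>R X_hb g mu s a p)
    \<le> exp (- (sqrt mu / 4) * t) * V_lyap f xs mu s p"
  using V_lyap_le_b_p[OF assms(3), of p tr] step_p_properties(4)[OF assms]
  by (smt (verit) exp_ge_zero mult_left_mono)

lemma gap_le_V_lyap: "f (fst p) - f xs \<le> V_lyap f xs mu s p / q"
  using q_pos by (auto simp: V_lyap_def field_simps split: prod.split)

end

theorem mainTheorem5:
  fixes f :: "real ^ 'n \<Rightarrow> real" and g :: "real ^ 'n \<Rightarrow> real ^ 'n"
    and xs :: "real ^ 'n" and p0 :: "(real ^ 'n) \<times> (real ^ 'n)"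
    and mu L s alpha a :: real and tr :: trigger
  assumes "mu > 0" and "L > 0" and "s > 0"
    and "\<And>x. GDERIV f x :> g x" and "continuous_on UNIV g"
    and "strongly_convex mu f g"
    and "L-lipschitz_on UNIV g"
    and "\<And>y. f xs \<le> f y"
    and "0 < alpha" and "alpha < 1"
    and "0 \<le> a" and "a \<le> a2_star alpha mu L s"
  shows "let p = dg_iter tr f g mu L s a p0;
        \<Delta> = dg_step tr f g mu L s a p0;
        perf = performed tr f g mu L s a p0 in
    MIET mu L s a > 0 \<and>
    (\<forall>eps>0. \<forall>k. perf eps k \<longrightarrow>
       (\<Delta> k > 0 \<and> b_p tr f g mu L s a (p k) (\<Delta> k) = 0 \<and>
         (\<forall>t>0. b_p tr f g mu L s a (p k) t = 0 \<longrightarrow> \<Delta> k \<le> t)) \<and>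
       MIET mu L s a \<le> \<Delta> k \<and>
       (\<forall>t\<in>{0..\<Delta> k}. V_lyap f xs mu s (p k + t *\<^sub>R X_hb g mu s a (p k))
            \<le> exp (- (sqrt mu / 4) * t) * V_lyap f xs mu s (p k))) \<and>
    (\<exists>C. \<forall>eps>0. \<forall>k. perf eps k \<longrightarrow>
       f (fst (p (Suc k))) - f xs \<le> C * exp (- (sqrt mu / 4) * (\<Sum>i\<le>k. \<Delta> i)))"
proof -
  interpret heavy_ball f g mu L xs s a
    by standard (use assms in auto)
  \<comment> \<open>Shifting every coordinate by 1 leaves the minimizer because the index type is
    nonempty; this yields \<open>mu \<le> L\<close>.\<close>
  obtain y :: "real ^ 'n" where "y \<noteq> xs"
    by (rule that[of "xs + vec 1"]) (simp add: vec_eq_iff)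
  then have eta: "eta > 0"
    using eta_pos[OF assms(9,10,12)] mu_le_L by blast
  define p \<Delta> perf where "p = dg_iter tr f g mu L s a p0"
    and "\<Delta> = dg_step tr f g mu L s a p0" and "perf = performed tr f g mu L s a p0"
  let ?V = "V_lyap f xs mu s"
  have \<Delta>: "\<Delta> k = step_p tr f g mu L s a (p k)" for k
    by (simp add: \<Delta>_def dg_step_def p_def)
  have p_Suc: "p (Suc k) = p k + \<Delta> k *\<^sub>R X_hb g mu s a (p k)" for k
    by (simp add: \<Delta> p_def Let_def)
  have nz: "g (fst (p k)) \<noteq> 0" if "eps > 0" "perf eps k" for eps k
    using that by (force simp: perf_def performed_def p_def)
  have step: "MIET mu L s a \<le> \<Delta> k" "\<Delta> k > 0" "b_p tr f g mu L s a (p k) (\<Delta> k) = 0"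
    "\<And>t. 0 < t \<Longrightarrow> b_p tr f g mu L s a (p k) t = 0 \<Longrightarrow> \<Delta> k \<le> t"
    "\<And>t. t \<in> {0..\<Delta> k} \<Longrightarrow>
      ?V (p k + t *\<^sub>R X_hb g mu s a (p k)) \<le> exp (- (sqrt mu / 4) * t) * ?V (p k)"
    if "eps > 0" "perf eps k" for eps k
  proof -
    note props = step_p_properties[OF nz[OF that] eta, where tr = tr, folded \<Delta>]
    show "MIET mu L s a \<le> \<Delta> k" "b_p tr f g mu L s a (p k) (\<Delta> k) = 0"
      "\<And>t. 0 < t \<Longrightarrow> b_p tr f g mu L s a (p k) t = 0 \<Longrightarrow> \<Delta> k \<le> t"
      by (fact props)+
    with MIET_pos[OF eta] show "\<Delta> k > 0" by linarith
    show "?V (p k + t *\<^sub>R X_hb g mu s a (p k)) \<le> exp (- (sqrt mu / 4) * t) * ?V (p k)"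
      if "t \<in> {0..\<Delta> k}" for t
      using V_lyap_step[OF nz[OF \<open>eps > 0\<close> \<open>perf eps k\<close>] eta, where tr = tr] that by (simp add: \<Delta>)
  qed
  have V: "?V (p (Suc k)) \<le> exp (- (sqrt mu / 4) * (\<Sum>i\<le>k. \<Delta> i)) * ?V p0"
    if "eps > 0" "perf eps k" for eps k
    using that(2)
  proof (induction k)
    case 0
    show ?case
      using step(5)[OF that(1) 0, of "\<Delta> 0"] step(2)[OF that(1) 0] by (simp add: p_Suc) (simp add: p_def)
  next
    case (Suc k)
    have "?V (p (Suc (Suc k))) \<le> exp (- (sqrt mu / 4) * \<Delta> (Suc k)) * ?V (p (Suc k))"
      unfolding p_Suc[of "Suc k"]
      using step(5)[OF that(1) Suc.prems, of "\<Delta> (Suc k)"] step(2)[OF that(1) Suc.prems] by simp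
    \<comment> \<open>An iteration is performed only if all earlier ones were, so the induction
      hypothesis applies. The sum up to \<open>k\<close> belongs to the point with index
      \<open>Suc k\<close>.\<close>
    also have "?V (p (Suc k)) \<le> exp (- (sqrt mu / 4) * (\<Sum>i\<le>k. \<Delta> i)) * ?V p0"
      using Suc by (simp add: perf_def performed_def)
    finally show ?case
      by (simp add: exp_add[symmetric] algebra_simps)
  qed
  have "f (fst (p (Suc k))) - f xs \<le> ?V p0 / q * exp (- (sqrt mu / 4) * (\<Sum>i\<le>k. \<Delta> i))"
    if "eps > 0" "perf eps k" for eps k
  proof -
    have "f (fst (p (Suc k))) - f xs \<le> ?V (p (Suc k)) / q"
      by (rule gap_le_V_lyap)
    also have "\<dots> \<le> exp (- (sqrt mu / 4) * (\<Sum>i\<le>k. \<Delta> i)) * ?V p0 / q"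
      using V[OF that] q_pos by (intro divide_right_mono) auto
    finally show ?thesis by (simp add: mult.commute)
  qed
  \<comment> \<open>The constant depends on the starting point but on neither \<open>eps\<close> nor
    \<open>k\<close>.\<close>
  then have "\<exists>C. \<forall>eps>0. \<forall>k. perf eps k \<longrightarrow>
      f (fst (p (Suc k))) - f xs \<le> C * exp (- (sqrt mu / 4) * (\<Sum>i\<le>k. \<Delta> i))"
    by (intro exI[of _ "?V p0 / q"] allI impI)
  then show ?thesis
    unfolding Let_def p_def[symmetric] \<Delta>_def[symmetric] perf_def[symmetric]
    by (intro conjI allI impI ballI MIET_pos[OF eta]) (erule (2) step | erule (1) step | assumption)+
qed

end
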